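(* Let $G$ be a finite abelian group, let $S$ be a symmetric set of non-identity elements of $G$ (i.e. if $s \in S$ then $s^{-1} \in S$), and let $X = \Gamma(G,S)$ be the Cayley graph of $G$ with respect to $S$. Let $t$ be the number of elements of $S$ of order $2$. Then for any $U \subseteq G$ of size $|U| > |G|/2$, the induced subgraph $X(U)$ of $X$ on $U$ has maximum degree at least $\sqrt{(|S|+t)/2}$.
   Context: For a finite group $G$ and a symmetric set $S$ of non-identity elements of $G$, the Cayley graph $\Gamma(G,S)$ is the undirected simple graph with vertex set $G$ and edge set $\{(g,sg) : g \in G, s \in S\}$. For a graph $X$ and a subset $U \subseteq V(X)$, the induced subgraph $X(U)$ has vertex set $U$ and edge set $\{(u_1,u_2) \in E(X) : u_1,u_2 \in U\}$. *)

theory Defs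
  imports Complex_Main "HOL-Algebra.Multiplicative_Group" "Graph_Theory.Digraph_Component"
begin

text \<open>
  As usual in \<^theory>\<open>Graph_Theory.Digraph\<close>, an undirected simple graph is a digraph
  satisfying the locale \<^locale>\<open>graph\<close>: it is finite, symmetric, and has neither loops nor
  parallel arcs. An undirected edge \<open>{u, v}\<close> is the pair of arcs \<open>(u, v)\<close> and \<open>(v, u)\<close>.
\<close>

definition symmetric_connection_set :: "('a, 'm) monoid_scheme \<Rightarrow> 'a set \<Rightarrow> bool" where
  "symmetric_connection_set G S \<longleftrightarrow>
     S \<subseteq> carrier G - {\<one>\<^bsub>G\<^esub>} \<and> (\<forall>s\<in>S. inv\<^bsub>G\<^esub> s \<in> S)"

definition cayley_graph :: "('a, 'm) monoid_scheme \<Rightarrow> 'a set \<Rightarrow> ('a, 'a \<times> 'a) pre_digraph" where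
  "cayley_graph G S =
     \<lparr>verts = carrier G, arcs = {(g, s \<otimes>\<^bsub>G\<^esub> g) | g s. g \<in> carrier G \<and> s \<in> S},
      tail = fst, head = snd\<rparr>"

text \<open>
  In a symmetric digraph without loops and parallel arcs the out-degree of a vertex is its number
  of neighbours, that is, its degree in the undirected graph. The value is only meaningful if the
  set of vertices is finite and nonempty.
\<close>

definition max_degree :: "('a, 'b) pre_digraph \<Rightarrow> nat" where
  "max_degree X = Max (out_degree X ` verts X)"

lemma graph_cayley_graph:
  assumes "group G" "finite (carrier G)" "symmetric_connection_set G S"
  shows "graph (cayley_graph G S)"
proof -
  interpret group G by fact
  have S: "S \<subseteq> carrier G" "\<one>\<^bsub>G\<^esub> \<notin> S" "\<And>s. s \<in> S \<Longrightarrow> inv\<^bsub>G\<^esub> s \<in> S"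
    using assms(3) by (auto simp: symmetric_connection_set_def)
  have fin: "finite (arcs (cayley_graph G S))"
  proof (rule finite_subset)
    show "arcs (cayley_graph G S) \<subseteq> carrier G \<times> carrier G"
      using S(1) by (auto simp: cayley_graph_def)
    show "finite (carrier G \<times> carrier G)"
      using assms(2) by simp
  qed
  have loop: "s \<otimes>\<^bsub>G\<^esub> g \<noteq> g" if "g \<in> carrier G" "s \<in> S" for g s
    using that S by (metis r_cancel_one subsetD)
  have sym: "\<exists>h t. s \<otimes>\<^bsub>G\<^esub> g = h \<and> g = t \<otimes>\<^bsub>G\<^esub> h \<and> h \<in> carrier G \<and> t \<in> S"
    if "g \<in> carrier G" "s \<in> S" for g s
  proof (intro exI conjI)
    show "g = inv\<^bsub>G\<^esub> s \<otimes>\<^bsub>G\<^esub> (s \<otimes>\<^bsub>G\<^esub> g)"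
      using that S(1) by (simp add: m_assoc[symmetric] subset_iff)
  qed (use that S in auto)
  have symmetric: "symmetric (cayley_graph G S)"
    using sym by (auto simp: symmetric_def arcs_ends_conv sym_def cayley_graph_def image_iff)
  show ?thesis
    using S(1) assms(2) fin loop loop[symmetric] symmetric
    by unfold_locales (auto simp: cayley_graph_def arc_to_ends_def)
qed

end

theory Submission
  imports Defs
begin

text \<open>
  The theorem reduces to Huang's theorem on the hypercube: more than half of the vertices of the
  \<open>d\<close>-dimensional cube always contain a vertex that has at least \<open>sqrt d\<close> neighbours among them.

  Choose a set \<open>R \<subseteq> S\<close> containing exactly one element of \<open>{s, s\<^sup>-\<^sup>1}\<close> for every \<open>s \<in> S\<close>. Then
  \<open>R \<union> R\<^sup>-\<^sup>1 = S\<close>, and \<open>R \<inter> R\<^sup>-\<^sup>1\<close> consists of the elements of \<open>S\<close> of order 2, so that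
  \<open>d = |R| = (|S| + t) / 2\<close> (lemma \<open>involution_transversal\<close>). For every \<open>g\<close> in the group, send a
  vertex \<open>x \<subseteq> R\<close> of the cube to \<open>(\<Prod>s\<in>x. s) g\<close>. Because the group is abelian, flipping the
  coordinate \<open>s\<close> multiplies the image by \<open>s\<close> or \<open>s\<^sup>-\<^sup>1\<close>, so adjacent vertices go to adjacent
  vertices; by the choice of \<open>R\<close>, distinct neighbours of a vertex have distinct images. For a fixed
  \<open>x\<close> the image is uniformly distributed when \<open>g\<close> is, so for some \<open>g\<close> more than half of the cube is
  mapped into \<open>U\<close>. Huang's theorem for this part of the cube gives a vertex of \<open>U\<close> of
  degree at least \<open>sqrt d\<close>.

  Huang's theorem itself is proved with a signed adjacency operator \<open>A\<close> of the cube that satisfies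
  \<open>A\<^sup>2 = d\<close>. Every function of the form \<open>w = A v + sqrt d v\<close> is then an eigenfunction for the
  eigenvalue \<open>sqrt d\<close>. Let \<open>v\<close> range over the functions supported on a facet, a space of dimension
  half the number of vertices: counting equations and unknowns, some nonzero \<open>v\<close> makes \<open>w\<close> vanish
  outside the given set \<open>H\<close>. At a vertex where \<open>|w|\<close> is maximal, the eigenvalue equation has at
  least \<open>sqrt d\<close> nonzero terms.
\<close>

section \<open>Underdetermined homogeneous linear systems\<close>

lemma homogeneous_system_nontrivial_solution:
  fixes a :: "'e \<Rightarrow> 'i \<Rightarrow> 'f::field"
  assumes "finite E" "finite I" "card E < card I"
  shows "\<exists>v. (\<exists>i\<in>I. v i \<noteq> 0) \<and> (\<forall>i. i \<notin> I \<longrightarrow> v i = 0) \<and> (\<forall>e\<in>E. (\<Sum>i\<in>I. a e i * v i) = 0)"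
  using assms
proof (induction E arbitrary: I a rule: finite_induct)
  case empty
  then obtain p where "p \<in> I" by fastforce
  then show ?case by (intro exI[of _ "\<lambda>i. if i = p then 1 else 0"]) auto
next
  case (insert e E)
  show ?case
  proof (cases "\<forall>i\<in>I. a e i = 0")
    case True
    have "card E < card I" using insert.hyps insert.prems by simp
    then obtain v where "\<exists>i\<in>I. v i \<noteq> 0" "\<forall>i. i \<notin> I \<longrightarrow> v i = 0"
        "\<forall>f\<in>E. (\<Sum>i\<in>I. a f i * v i) = 0"
      using insert.IH[OF insert.prems(1), of a] by blast
    with True show ?thesis by (intro exI[of _ v]) simp
  next
    case False
    then obtain p where p: "p \<in> I" "a e p \<noteq> 0" by blast
    \<comment> \<open>Gaussian elimination of the unknown \<open>p\<close> by means of the equation \<open>e\<close>\<close>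
    define J where "J = I - {p}"
    define b where "b f i = a f i - a f p / a e p * a e i" for f i
    have "card E < card J" using insert.hyps insert.prems p by (simp add: J_def)
    then obtain v where v: "\<exists>i\<in>J. v i \<noteq> 0" "\<forall>i. i \<notin> J \<longrightarrow> v i = 0"
        "\<forall>f\<in>E. (\<Sum>i\<in>J. b f i * v i) = 0"
      using insert.IH[of J b] insert.prems(1) by (auto simp: J_def)
    define c where "c = - (\<Sum>i\<in>J. a e i * v i) / a e p"
    have sum: "(\<Sum>i\<in>I. a f i * (v(p := c)) i) = a f p * c + (\<Sum>i\<in>J. a f i * v i)" for f
    proof -
      have "(\<Sum>i\<in>I. a f i * (v(p := c)) i) = a f p * c + (\<Sum>i\<in>J. a f i * (v(p := c)) i)"
        using p insert.prems(1) by (simp add: J_def sum.remove[of I p])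
      also have "(\<Sum>i\<in>J. a f i * (v(p := c)) i) = (\<Sum>i\<in>J. a f i * v i)"
        by (rule sum.cong) (auto simp: J_def)
      finally show ?thesis .
    qed
    have "(\<Sum>i\<in>I. a f i * (v(p := c)) i) = 0" if "f \<in> E" for f
    proof -
      have "0 = (\<Sum>i\<in>J. b f i * v i)" using v(3) that by simp
      also have "\<dots> = (\<Sum>i\<in>J. a f i * v i) - a f p / a e p * (\<Sum>i\<in>J. a e i * v i)"
        by (simp add: b_def left_diff_distrib sum_subtractf sum_distrib_left mult.assoc)
      also have "\<dots> = a f p * c + (\<Sum>i\<in>J. a f i * v i)" by (simp add: c_def)
      finally show ?thesis using sum by simp
    qed
    moreover have "(\<Sum>i\<in>I. a e i * (v(p := c)) i) = 0"
      unfolding sum using p by (simp add: c_def)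
    moreover have "\<exists>i\<in>I. (v(p := c)) i \<noteq> 0" "\<forall>i. i \<notin> I \<longrightarrow> (v(p := c)) i = 0"
      using v p by (auto simp: J_def)
    ultimately show ?thesis by (intro exI[of _ "v(p := c)"]) blast
  qed
qed

section \<open>Huang's theorem on induced subgraphs of the hypercube\<close>

text \<open>
  The vertices of the cube with coordinate set \<open>R\<close> are the subsets of \<open>R\<close>; the neighbours of \<open>x\<close>
  are the sets \<open>flip i x\<close> with \<open>i \<in> R\<close>.
\<close>

definition flip :: "'i \<Rightarrow> 'i set \<Rightarrow> 'i set" where
  "flip i x = (if i \<in> x then x - {i} else insert i x)"

lemma mem_flip: "k \<in> flip i x \<longleftrightarrow> (if k = i then i \<notin> x else k \<in> x)"
  by (auto simp: flip_def)

lemma flip_flip [simp]: "flip i (flip i x) = x"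
  by (auto simp: mem_flip split: if_splits)

lemma flip_commute: "flip i (flip j x) = flip j (flip i x)"
  by (auto simp: mem_flip split: if_splits)

lemma flip_subset: "i \<in> R \<Longrightarrow> x \<subseteq> R \<Longrightarrow> flip i x \<subseteq> R"
  by (auto simp: flip_def)

lemma power_card_flip:
  assumes "finite x"
  shows "(-1) ^ card (flip i x) = - ((-1) ^ card x :: 'f::ring_1)"
proof (cases "i \<in> x")
  case True
  then have "card x = Suc (card (x - {i}))" using assms by (intro card.remove)
  then have "(-1) ^ card x = - ((-1) ^ card (x - {i}) :: 'f)"
    by (simp only: power_Suc mult_minus1)
  then show ?thesis using True by (simp add: flip_def)
qed (use assms in \<open>simp add: flip_def\<close>)

text \<open>The sign of the edge between \<open>x\<close> and \<open>flip i x\<close> in Huang's signing of the cube.\<close>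

definition edge_sign :: "'i::linorder \<Rightarrow> 'i set \<Rightarrow> real" where
  "edge_sign i x = (-1) ^ card {k \<in> x. k < i}"

lemma abs_edge_sign [simp]: "\<bar>edge_sign i x\<bar> = 1"
  by (simp add: edge_sign_def power_abs)

lemma edge_sign_square [simp]: "edge_sign i x * edge_sign i x = 1"
  by (metis abs_edge_sign abs_mult_self_eq mult_1)

lemma edge_sign_flip:
  assumes "finite x"
  shows "edge_sign j (flip i x) = (if i < j then - edge_sign j x else edge_sign j x)"
proof -
  have "{k \<in> flip i x. k < j} = (if i < j then flip i {k \<in> x. k < j} else {k \<in> x. k < j})"
    by (auto simp: mem_flip)
  then show ?thesis using assms by (simp add: edge_sign_def power_card_flip)
qed

text \<open>
  The adjacency operator of the cube, weighted by the edge signs, acting on real functions of the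
  vertices.
\<close>

definition signed_adjacency :: "'i::linorder set \<Rightarrow> ('i set \<Rightarrow> real) \<Rightarrow> 'i set \<Rightarrow> real" where
  "signed_adjacency R f x = (\<Sum>i\<in>R. edge_sign i x * f (flip i x))"

text \<open>
  The two paths of length 2 between opposite corners of a square carry opposite signs, so only the
  closed paths from \<open>x\<close> to a neighbour and back contribute.
\<close>

lemma signed_adjacency_square:
  assumes "finite R" "x \<subseteq> R"
  shows "signed_adjacency R (signed_adjacency R f) x = real (card R) * f x"
proof -
  define h where
    "h i j = edge_sign i x * (edge_sign j (flip i x) * f (flip j (flip i x)))" for i j
  have fin: "finite x" using assms finite_subset by blast
  have h: "h i j + h j i = (if i = j then 2 * f x else 0)" for i j
  proof (cases i j rule: linorder_cases)
    case equal
    then show ?thesis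
      using edge_sign_square[of i x] by (simp add: h_def edge_sign_flip fin mult.assoc[symmetric])
  qed (auto simp: h_def edge_sign_flip fin flip_commute[of j i])
  have eq: "signed_adjacency R (signed_adjacency R f) x = (\<Sum>i\<in>R. \<Sum>j\<in>R. h i j)"
    by (simp add: signed_adjacency_def h_def sum_distrib_left)
  moreover have "(\<Sum>i\<in>R. \<Sum>j\<in>R. h i j) = (\<Sum>i\<in>R. \<Sum>j\<in>R. h j i)"
    by (rule sum.swap)
  ultimately have "2 * signed_adjacency R (signed_adjacency R f) x
      = (\<Sum>i\<in>R. \<Sum>j\<in>R. h i j + h j i)"
    by (simp add: sum.distrib)
  also have "\<dots> = 2 * (real (card R) * f x)"
    using assms(1) by (simp add: h)
  finally show ?thesis by simp
qed

lemma signed_adjacency_add: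
  "signed_adjacency R (\<lambda>y. f y + c * g y) x
    = signed_adjacency R f x + c * signed_adjacency R g x"
  by (simp add: signed_adjacency_def distrib_left sum.distrib sum_distrib_left mult.left_commute)

theorem Huang_induced_subcube_degree:
  fixes R :: "'i::linorder set"
  assumes R: "finite R" and H: "H \<subseteq> Pow R" "2 ^ card R < 2 * card H"
  shows "\<exists>x\<in>H. sqrt (real (card R)) \<le> real (card {i \<in> R. flip i x \<in> H})"
proof (cases "R = {}")
  case True
  have "H \<noteq> {}" using H(2) by auto
  then show ?thesis using True by auto
next
  case False
  then obtain n where n: "n \<in> R" by blast
  let ?d = "real (card R)"
  let ?A = "signed_adjacency R"
  define I where "I = Pow (R - {n})"
  define E where "E = Pow R - H"
  have fin: "finite E" "finite I" "finite H"
    using R H(1) finite_subset by (auto simp: E_def I_def)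
  have card_R: "card R = Suc (card (R - {n}))" using R n by (rule card.remove)
  have "card E = 2 ^ card R - card H"
    using H(1) R fin(3) by (simp add: E_def card_Diff_subset card_Pow)
  moreover have "card I = 2 ^ card (R - {n})"
    using R by (simp add: I_def card_Pow)
  ultimately have "card E < card I"
    using H(2) zero_less_power[OF pos2, of "card (R - {n})"] unfolding card_R power_Suc
    by linarith
  \<comment> \<open>the matrix of \<open>v \<mapsto> A v + sqrt d v\<close> in terms of the values of \<open>v\<close> on the facet \<open>I\<close>\<close>
  define a where
    "a e x = (\<Sum>i\<in>R. if flip i e = x then edge_sign i e else 0) + (if e = x then sqrt ?d else 0)"
    for e x :: "'i set"
  obtain v where v: "\<exists>x\<in>I. v x \<noteq> 0" "\<forall>x. x \<notin> I \<longrightarrow> v x = 0" "\<forall>e\<in>E. (\<Sum>x\<in>I. a e x * v x) = 0"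
    using homogeneous_system_nontrivial_solution[OF fin(1,2) \<open>card E < card I\<close>, of a] by blast
  define w where "w x = ?A v x + sqrt ?d * v x" for x
  have pick: "(\<Sum>x\<in>I. if y = x then c * v x else 0) = c * v y" for c y
    using v(2) fin(2) by (simp add: sum.delta)
  have a: "(\<Sum>x\<in>I. a e x * v x) = w e" for e
  proof -
    have "(\<Sum>x\<in>I. a e x * v x)
        = (\<Sum>x\<in>I. (\<Sum>i\<in>R. if flip i e = x then edge_sign i e * v x else 0)
                   + (if e = x then sqrt ?d * v x else 0))"
      by (simp add: a_def distrib_right sum_distrib_right if_distrib[of "\<lambda>c. c * v x" for x]
          cong: if_cong)
    also have "\<dots> = (\<Sum>i\<in>R. \<Sum>x\<in>I. if flip i e = x then edge_sign i e * v x else 0) + sqrt ?d * v e"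
      by (simp only: sum.distrib pick sum.swap[of _ R I])
    finally show ?thesis by (simp only: pick w_def signed_adjacency_def)
  qed
  have w_E: "w x = 0" if "x \<subseteq> R" "x \<notin> H" for x
    using v(3) that a by (auto simp: E_def)
  have eigen: "?A w x = sqrt ?d * w x" if "x \<subseteq> R" for x
  proof -
    have "?A w x = ?A (?A v) x + sqrt ?d * ?A v x"
      using signed_adjacency_add[of R "?A v" "sqrt ?d" v x] by (simp add: w_def[abs_def])
    then show ?thesis using signed_adjacency_square[OF R that]
      by (simp add: w_def distrib_left mult.assoc[symmetric])
  qed
  have "\<exists>x\<in>Pow R. w x \<noteq> 0"
  proof -
    obtain y where y: "y \<in> I" "v y \<noteq> 0" using v(1) by blast
    \<comment> \<open>\<open>flip n y\<close> lies in the facet opposite to \<open>I\<close>, and \<open>y\<close> is its only neighbour in \<open>I\<close>\<close>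
    have "n \<notin> y" using y by (auto simp: I_def)
    have v_0: "v x = 0" if "n \<in> x" for x
      using v(2) that by (auto simp: I_def)
    have "v (flip i (flip n y)) = (if i = n then v y else 0)" for i
      using v_0[of "flip i (flip n y)"] \<open>n \<notin> y\<close> by (simp add: mem_flip)
    moreover have "v (flip n y) = 0"
      using v_0[of "flip n y"] \<open>n \<notin> y\<close> by (simp add: mem_flip)
    ultimately have "w (flip n y) = edge_sign n (flip n y) * v y"
      using R n by (simp add: w_def signed_adjacency_def if_distrib[of "\<lambda>z. _ * z"] cong: if_cong)
    then have "w (flip n y) \<noteq> 0"
      using y(2) by (simp add: edge_sign_def)
    moreover have "flip n y \<subseteq> R" using y n by (auto simp: I_def flip_def)
    ultimately show ?thesis by blast
  qed
  then obtain z where z: "z \<in> Pow R" "w z \<noteq> 0" by blast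
  define M where "M = Max ((\<lambda>x. \<bar>w x\<bar>) ` Pow R)"
  have "M \<in> (\<lambda>x. \<bar>w x\<bar>) ` Pow R" unfolding M_def using R by (intro Max_in) auto
  then obtain x where x: "x \<subseteq> R" "\<bar>w x\<bar> = M" by auto
  have M: "\<bar>w y\<bar> \<le> M" if "y \<subseteq> R" for y
    unfolding M_def using R that by (intro Max_ge) auto
  have "M > 0" using M[of z] z by auto
  let ?N = "{i \<in> R. flip i x \<in> H}"
  have "sqrt ?d * M = \<bar>?A w x\<bar>" using x by (simp add: eigen abs_mult)
  also have "\<dots> \<le> (\<Sum>i\<in>R. \<bar>w (flip i x)\<bar>)"
    unfolding signed_adjacency_def by (rule order_trans[OF sum_abs]) (simp add: abs_mult)
  also have "\<dots> = (\<Sum>i\<in>?N. \<bar>w (flip i x)\<bar>)"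
    using R x(1) by (intro sum.mono_neutral_right) (auto simp: w_E flip_subset)
  also have "\<dots> \<le> (\<Sum>i\<in>?N. M)"
    using x(1) by (intro sum_mono M) (auto simp: flip_subset)
  also have "\<dots> = real (card ?N) * M" by simp
  finally have "sqrt ?d \<le> real (card ?N)" using \<open>M > 0\<close> by simp
  moreover have "x \<in> H" using w_E[OF x(1)] x(2) \<open>M > 0\<close> by force
  ultimately show ?thesis by blast
qed

section \<open>From the hypercube to abelian Cayley graphs\<close>

text \<open>The set \<open>R\<close> contains exactly one element of each orbit \<open>{s, f s}\<close> of the involution.\<close>

lemma involution_transversal:
  assumes "\<And>s. s \<in> S \<Longrightarrow> f s \<in> S" "\<And>s. s \<in> S \<Longrightarrow> f (f s) = s"
  obtains R where "R \<union> f ` R = S" "R \<inter> f ` R = {s \<in> S. f s = s}"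
proof -
  define rep where "rep s = (SOME x. x \<in> {s, f s})" for s
  have rep: "rep s \<in> {s, f s}" for s
    unfolding rep_def by (rule someI[of _ s]) simp
  have rep_f: "rep (f s) = rep s" if "s \<in> S" for s
    using assms(2)[OF that] by (simp add: rep_def insert_commute)
  have R_S: "rep s \<in> S" if "s \<in> S" for s
    using rep[of s] assms that by auto
  have union: "s \<in> rep ` S \<union> f ` rep ` S" if "s \<in> S" for s
  proof (cases "rep s = s")
    case True
    then show ?thesis using that by force
  next
    case False
    then have "s = f (rep s)" using rep[of s] assms that by auto
    then show ?thesis using that by blast
  qed
  have idem: "rep (rep s) = rep s" if "s \<in> S" for s
    using rep[of s] rep_f[OF that] by auto
  have "f s = s" if s: "s \<in> rep ` S" "s \<in> f ` rep ` S" for s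
  proof -
    obtain u where u: "u \<in> S" "s = f (rep u)" using s(2) by blast
    have "s = rep s" using s(1) idem by auto
    also have "\<dots> = rep u" using u idem rep_f R_S by simp
    finally show ?thesis using u by simp
  qed
  moreover have "s \<in> rep ` S \<and> s \<in> f ` rep ` S" if "s \<in> S" "f s = s" for s
    using rep[of s] that by force
  ultimately show ?thesis
    using that[of "rep ` S"] union assms(1) R_S by blast
qed

context group
begin

lemma inv_eq_self_iff_ord:
  assumes "s \<in> carrier G" "s \<noteq> \<one>"
  shows "inv s = s \<longleftrightarrow> ord s = 2"
proof
  assume "inv s = s"
  then have "s \<otimes> s = \<one>" using assms by (metis l_inv)
  then have "s [^] (2::nat) = \<one>" using assms by (simp add: numeral_2_eq_2)
  then have "ord s dvd 2" using assms by (simp add: pow_eq_id)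
  then have "ord s \<noteq> 0" "ord s \<le> 2" by (auto intro: dvd_imp_le intro!: Nat.gr0I)
  moreover have "ord s \<noteq> 1" using assms by (simp add: ord_eq_1 del: One_nat_def)
  ultimately show "ord s = 2" by linarith
next
  assume "ord s = 2"
  then have "s [^] (2::nat) = \<one>" using pow_ord_eq_1[OF assms(1)] by simp
  then have "s \<otimes> s = \<one>" using assms by (simp add: numeral_2_eq_2)
  then show "inv s = s" using assms by (simp add: inv_equality)
qed

text \<open>
  Representatives of \<open>S\<close> modulo inversion, distinct and enumerated by natural numbers because the
  signing of the cube needs linearly ordered coordinates.
\<close>

lemma connection_set_representatives:
  assumes "finite (carrier G)" "symmetric_connection_set G S"
  shows "\<exists>d r. 2 * d = card S + card {s \<in> S. ord s = 2} \<and> r ` {..<d} \<subseteq> S \<and>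
    (\<forall>i<d. \<forall>j<d. {r i, inv (r i)} \<inter> {r j, inv (r j)} \<noteq> {} \<longrightarrow> i = j)"
proof -
  have S: "S \<subseteq> carrier G" "\<one> \<notin> S" "\<And>s. s \<in> S \<Longrightarrow> inv s \<in> S"
    using assms(2) by (auto simp: symmetric_connection_set_def)
  obtain R where R: "R \<union> m_inv G ` R = S" "R \<inter> m_inv G ` R = {s \<in> S. inv s = s}"
  proof (rule involution_transversal[of S "m_inv G"])
    show "inv (inv s) = s" if "s \<in> S" for s using S(1) that by auto
  qed (use S(3) in auto)
  have fin: "finite R"
    using R(1) S(1) assms(1) by (metis finite_Un finite_subset)
  have R_carrier: "R \<subseteq> carrier G" using R S by blast
  then have "card (m_inv G ` R) = card R"
    by (intro card_image inj_on_subset[OF inv_inj])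
  moreover have "{s \<in> S. inv s = s} = {s \<in> S. ord s = 2}"
    using S inv_eq_self_iff_ord by (metis subsetD)
  ultimately have card: "2 * card R = card S + card {s \<in> S. ord s = 2}"
    using card_Un_Int[OF fin finite_imageI[OF fin], of "m_inv G"] R by simp
  obtain r where r: "bij_betw r {..<card R} R"
    using ex_bij_betw_nat_finite[OF fin] by (auto simp: atLeast0LessThan)
  then have r_R: "r i \<in> R" if "i < card R" for i
    using that by (auto simp: bij_betw_def)
  have distinct: "i = j" if ij: "i < card R" "j < card R" "{r i, inv (r i)} \<inter> {r j, inv (r j)} \<noteq> {}" for i j
  proof -
    have carr: "r i \<in> carrier G" "r j \<in> carrier G" using ij r_R R_carrier by auto
    have "r i = r j \<or> r i = inv (r j)" using ij(3) carr by auto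
    moreover have "r i = r j" if eq: "r i = inv (r j)"
    proof -
      have "r i \<in> R \<inter> m_inv G ` R" using eq r_R[OF ij(1)] r_R[OF ij(2)] by blast
      then have "inv (r i) = r i" using R(2) by blast
      then show ?thesis using eq carr by (metis inv_inv)
    qed
    ultimately show "i = j" using r ij unfolding bij_betw_def inj_on_def by blast
  qed
  have "r ` {..<card R} \<subseteq> S" using r_R R(1) by auto
  then show ?thesis
    by (intro exI[of _ "card R"] exI[of _ r] conjI card allI impI distinct)
qed

text \<open>
  Averaging over \<open>g\<close>: if \<open>U\<close> contains more than half of the group, then some translate of the map
  \<open>f\<close> sends more than half of \<open>X\<close> into \<open>U\<close>.
\<close>

lemma exists_dense_translate:
  assumes "finite (carrier G)" "U \<subseteq> carrier G" "card (carrier G) < 2 * card U"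
    and "finite X" "X \<noteq> {}" "f ` X \<subseteq> carrier G"
  shows "\<exists>g\<in>carrier G. card X < 2 * card {x \<in> X. f x \<otimes> g \<in> U}"
proof (rule ccontr)
  assume "\<not> ?thesis"
  then have le: "2 * card {x \<in> X. f x \<otimes> g \<in> U} \<le> card X" if "g \<in> carrier G" for g
    using that by force
  have fibre: "card {g \<in> carrier G. f x \<otimes> g \<in> U} = card U" if "x \<in> X" for x
  proof (rule bij_betw_same_card[of "\<lambda>g. f x \<otimes> g"])
    have fx: "f x \<in> carrier G" using assms that by blast
    have "u \<in> (\<lambda>g. f x \<otimes> g) ` {g \<in> carrier G. f x \<otimes> g \<in> U}" if "u \<in> U" for u
      using fx that assms(2) by (intro image_eqI[of _ _ "inv (f x) \<otimes> u"])
        (auto simp: m_assoc[symmetric])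
    then show "bij_betw (\<lambda>g. f x \<otimes> g) {g \<in> carrier G. f x \<otimes> g \<in> U} U"
      using fx by (auto simp: bij_betw_def inj_on_def)
  qed
  have "card X * card U = (\<Sum>x\<in>X. card {g \<in> carrier G. f x \<otimes> g \<in> U})"
    by (simp add: fibre)
  also have "\<dots> = (\<Sum>g\<in>carrier G. card {x \<in> X. f x \<otimes> g \<in> U})"
    using assms by (intro sum_multicount_gen) auto
  finally have "card X * (2 * card U) = (\<Sum>g\<in>carrier G. 2 * card {x \<in> X. f x \<otimes> g \<in> U})"
    by (simp add: sum_distrib_left[symmetric])
  also have "\<dots> \<le> card X * card (carrier G)"
    using sum_mono[of "carrier G", OF le] by (simp add: mult.commute)
  finally show False using assms by (auto simp: card_gt_0_iff)
qed

end

lemma (in comm_group) finprod_flip: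
  assumes "finite x" "r ` insert i x \<subseteq> carrier G"
  shows "finprod G r (flip i x) = (if i \<in> x then inv (r i) else r i) \<otimes> finprod G r x"
proof (cases "i \<in> x")
  case True
  have x: "x = insert i (x - {i})" using True by blast
  have carr: "r i \<in> carrier G" "r \<in> (x - {i}) \<rightarrow> carrier G" using assms by auto
  have "finprod G r (insert i (x - {i})) = r i \<otimes> finprod G r (x - {i})"
    using assms(1) carr by (intro finprod_insert) auto
  then have "finprod G r x = r i \<otimes> finprod G r (x - {i})" using x by simp
  then show ?thesis using True carr by (simp add: flip_def m_assoc[symmetric])
qed (use assms in \<open>auto simp: flip_def image_subset_iff_funcset intro!: finprod_insert\<close>)

lemma card_neighbours_le_max_degree:
  assumes "finite U" "u \<in> U" "u \<in> carrier G" "T \<subseteq> S" "(\<lambda>s. s \<otimes>\<^bsub>G\<^esub> u) ` T \<subseteq> U"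
    and "inj_on (\<lambda>s. s \<otimes>\<^bsub>G\<^esub> u) T"
  shows "card T \<le> max_degree (induce_subgraph (cayley_graph G S) U)" (is "_ \<le> max_degree ?X")
proof -
  have "card T = card ((\<lambda>s. (u, s \<otimes>\<^bsub>G\<^esub> u)) ` T)"
    using assms(6) by (intro card_image[symmetric]) (auto simp: inj_on_def)
  also have "\<dots> \<le> card (out_arcs ?X u)"
  proof (rule card_mono)
    have "out_arcs ?X u \<subseteq> {u} \<times> U" by (auto simp: out_arcs_def cayley_graph_def)
    then show "finite (out_arcs ?X u)" using assms(1) finite_subset by blast
    show "(\<lambda>s. (u, s \<otimes>\<^bsub>G\<^esub> u)) ` T \<subseteq> out_arcs ?X u"
      using assms by (auto simp: out_arcs_def cayley_graph_def)
  qed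
  also have "\<dots> \<le> max_degree ?X"
    unfolding max_degree_def out_degree_def[symmetric] using assms(1,2)
    by (intro Max_ge) auto
  finally show ?thesis .
qed

theorem theorem2p1:
  fixes G :: "('a, 'm) monoid_scheme" and S U :: "'a set" and t :: nat
  assumes "comm_group G" and "finite (carrier G)"
    and "symmetric_connection_set G S"
    and "t = card {s \<in> S. group.ord G s = 2}"
    and "U \<subseteq> carrier G" and "real (card U) > real (card (carrier G)) / 2"
  shows "real (max_degree (induce_subgraph (cayley_graph G S) U)) \<ge> sqrt ((real (card S) + real t) / 2)"
proof -
  interpret comm_group G by fact
  have S: "S \<subseteq> carrier G" "\<And>s. s \<in> S \<Longrightarrow> inv\<^bsub>G\<^esub> s \<in> S"
    using assms(3) by (auto simp: symmetric_connection_set_def)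
  obtain d r where d: "2 * d = card S + t" and r_S: "r ` {..<d} \<subseteq> S"
    and r: "\<forall>i<d. \<forall>j<d. {r i, inv\<^bsub>G\<^esub> (r i)} \<inter> {r j, inv\<^bsub>G\<^esub> (r j)} \<noteq> {} \<longrightarrow> i = j"
    using connection_set_representatives[OF assms(2,3)] unfolding assms(4)[symmetric] by blast
  have r_carrier: "r ` {..<d} \<subseteq> carrier G" using r_S S by blast
  have prod_carrier: "finprod G r x \<in> carrier G" if "x \<subseteq> {..<d}" for x
    using that r_carrier by (intro finprod_closed) auto
  have "\<exists>g\<in>carrier G. card (Pow {..<d}) < 2 * card {x \<in> Pow {..<d}. finprod G r x \<otimes>\<^bsub>G\<^esub> g \<in> U}"
    using assms prod_carrier by (intro exists_dense_translate) auto
  then obtain g where g: "g \<in> carrier G"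
      "card (Pow {..<d}) < 2 * card {x \<in> Pow {..<d}. finprod G r x \<otimes>\<^bsub>G\<^esub> g \<in> U}"
    by blast
  define H where "H = {x \<in> Pow {..<d}. finprod G r x \<otimes>\<^bsub>G\<^esub> g \<in> U}"
  have "\<exists>x\<in>H. sqrt (real (card {..<d})) \<le> real (card {i \<in> {..<d}. flip i x \<in> H})"
    using g(2) by (intro Huang_induced_subcube_degree) (auto simp: H_def card_Pow)
  then obtain x where x: "x \<in> H" "sqrt (real d) \<le> real (card {i \<in> {..<d}. flip i x \<in> H})"
    by auto
  define N where "N = {i \<in> {..<d}. flip i x \<in> H}"
  define u where "u = finprod G r x \<otimes>\<^bsub>G\<^esub> g"
  \<comment> \<open>flipping the coordinate \<open>i\<close> of \<open>x\<close> removes or adds the factor \<open>r i\<close>\<close>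
  define s where "s i = (if i \<in> x then inv\<^bsub>G\<^esub> (r i) else r i)" for i
  have x_d: "x \<subseteq> {..<d}" "u \<in> U" using x by (auto simp: H_def u_def)
  have u: "u \<in> carrier G" using x_d assms(5) by blast
  have s_S: "s i \<in> S" if "i < d" for i using that r_S S by (auto simp: s_def)
  have step: "finprod G r (flip i x) \<otimes>\<^bsub>G\<^esub> g = s i \<otimes>\<^bsub>G\<^esub> u" if "i < d" for i
  proof -
    have "finite x" using x_d(1) by (rule finite_subset) simp
    moreover have "r ` insert i x \<subseteq> carrier G" using x_d(1) that r_carrier by auto
    ultimately have "finprod G r (flip i x) = s i \<otimes>\<^bsub>G\<^esub> finprod G r x"
      by (simp add: finprod_flip s_def)
    then show ?thesis
      using s_S[OF that] S g prod_carrier x_d by (simp add: u_def m_assoc subset_iff)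
  qed
  have "inj_on s N"
  proof (rule inj_onI)
    fix i j assume ij: "i \<in> N" "j \<in> N" "s i = s j"
    then have "s i \<in> {r i, inv\<^bsub>G\<^esub> (r i)} \<inter> {r j, inv\<^bsub>G\<^esub> (r j)}"
      by (auto simp: s_def split: if_splits)
    then show "i = j" using r ij(1,2) by (auto simp: N_def)
  qed
  then have "card N = card (s ` N)" by (simp add: card_image)
  also have "\<dots> \<le> max_degree (induce_subgraph (cayley_graph G S) U)"
  proof (rule card_neighbours_le_max_degree)
    show "finite U" using assms finite_subset by blast
    show "s ` N \<subseteq> S" using s_S by (auto simp: N_def)
    then show "inj_on (\<lambda>s. s \<otimes>\<^bsub>G\<^esub> u) (s ` N)"
      using S(1) u by (auto simp: inj_on_def subset_iff)
    show "(\<lambda>s. s \<otimes>\<^bsub>G\<^esub> u) ` s ` N \<subseteq> U"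
      by (auto simp: N_def H_def step[symmetric])
  qed (use x_d u in auto)
  finally have "sqrt (real d) \<le> real (max_degree (induce_subgraph (cayley_graph G S) U))"
    using x(2) unfolding N_def by linarith
  moreover have "real d = (real (card S) + real t) / 2"
    using arg_cong[OF d, of real] by simp
  ultimately show ?thesis by simp
qed

end
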